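(* Let $p>3$ be a prime and $G=D_{2p}$ the dihedral group of order $2p$. Let $k\ge3$ be an integer and $f:G\to G$ any function. If $f$ passes $\mathsf{Test\_Dihedral}_k(f)$ with probability $\delta_k(f)$, then there exists an automorphism $\varphi\in\mathrm{Aut}(G)$ with $\mathrm{agr}(f,\varphi)\ge\frac12\,\delta_k(f)^{\frac{1}{k-2}}$.
   Context: $\mathrm{agr}(f,\varphi)=\Pr_{x\sim G}[f(x)=\varphi(x)]$, $x$ uniform. For $\vec x=(x_1,\dots,x_k)\in G^k$, let $\Gamma_{\vec x}:\mathrm{Aut}(G)\to G^k$, $\varphi\mapsto(\varphi(x_1),\dots,\varphi(x_k))$, and $\mathsf{G}_{\vec x}$ its image; let $\mathrm{Stab}(\vec x)=\{\varphi\in\mathrm{Aut}(G):\varphi(x_i)=x_i\ \forall i\}$. $\mathsf{Test\_Dihedral}_k(f)$: sample $\vec x\in G^k$ with probability proportional to $|\mathrm{Stab}(\vec x)|$; accept iff $(f(x_1),\dots,f(x_k))\in\mathsf{G}_{\vec x}$, i.e. iff some automorphism $\varphi$ satisfies $\varphi(x_i)=f(x_i)$ for all $i$. *)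

theory Defs
  imports "HOL-Algebra.Bij" "HOL-Algebra.Coset" "HOL-Probability.Probability"
begin

text \<open>The dihedral group of order \<open>2n\<close>. The pair \<open>(a, s)\<close> stands for
  \<open>\<rho>\<^sup>a \<sigma>\<^sup>s\<close>, where \<open>\<rho>\<close> is a rotation of order \<open>n\<close> and \<open>\<sigma>\<close> a reflection with
  \<open>\<sigma> \<rho> \<sigma> = \<rho>\<^sup>-\<^sup>1\<close>; thus \<open>\<rho>\<^sup>a \<sigma> \<rho>\<^sup>b \<sigma>\<^sup>t = \<rho>\<^sup>a\<^sup>-\<^sup>b \<sigma>\<^sup>1\<^sup>+\<^sup>t\<close>.\<close>

definition dihedral :: "nat \<Rightarrow> (int \<times> bool) monoid" where
  "dihedral n =
    \<lparr>carrier = {0..<int n} \<times> UNIV,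
     monoid.mult = (\<lambda>(a, s) (b, t). ((if s then a - b else a + b) mod int n, s \<noteq> t)),
     monoid.one = (0, False)\<rparr>"

lemma group_dihedral:
  assumes "n > 0"
  shows "group (dihedral n)"
proof (rule groupI)
  fix x assume "x \<in> carrier (dihedral n)"
  then obtain a s where x: "x = (a, s)" "0 \<le> a" "a < int n"
    by (auto simp: dihedral_def)
  define y where "y = (if s then (a, s) else ((- a) mod int n, s))"
  have "y \<in> carrier (dihedral n)" "y \<otimes>\<^bsub>dihedral n\<^esub> x = \<one>\<^bsub>dihedral n\<^esub>"
    using x assms by (auto simp: dihedral_def y_def mod_simps)
  thus "\<exists>y\<in>carrier (dihedral n). y \<otimes>\<^bsub>dihedral n\<^esub> x = \<one>\<^bsub>dihedral n\<^esub>"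
    by blast
qed (use assms in \<open>auto simp: dihedral_def mod_simps algebra_simps\<close>)

lemma order_dihedral: "Coset.order (dihedral n) = 2 * n"
  by (simp add: Coset.order_def dihedral_def card_cartesian_product)

definition agr :: "('a, 'b) monoid_scheme \<Rightarrow> ('a \<Rightarrow> 'a) \<Rightarrow> ('a \<Rightarrow> 'a) \<Rightarrow> real" where
  "agr G f \<phi> = measure_pmf.prob (pmf_of_set (carrier G)) {x. f x = \<phi> x}"

definition tuples :: "('a, 'b) monoid_scheme \<Rightarrow> nat \<Rightarrow> (nat \<Rightarrow> 'a) set" where
  "tuples G k = {1..k} \<rightarrow>\<^sub>E carrier G"

text \<open>\<open>auto G\<close> consists of extensional maps, so that for finite \<open>G\<close> automorphisms are
  identified with their restrictions to the carrier and stabilizers are finite.\<close>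

definition Gamma :: "nat \<Rightarrow> (nat \<Rightarrow> 'a) \<Rightarrow> ('a \<Rightarrow> 'a) \<Rightarrow> (nat \<Rightarrow> 'a)" where
  "Gamma k x \<phi> = (\<lambda>i\<in>{1..k}. \<phi> (x i))"

definition Gamma_image :: "('a, 'b) monoid_scheme \<Rightarrow> nat \<Rightarrow> (nat \<Rightarrow> 'a) \<Rightarrow> (nat \<Rightarrow> 'a) set" where
  "Gamma_image G k x = Gamma k x ` auto G"

definition Stab :: "('a, 'b) monoid_scheme \<Rightarrow> nat \<Rightarrow> (nat \<Rightarrow> 'a) \<Rightarrow> ('a \<Rightarrow> 'a) set" where
  "Stab G k x = {\<phi> \<in> auto G. \<forall>i\<in>{1..k}. \<phi> (x i) = x i}"

text \<open>The distribution on \<open>G\<^sup>k\<close> with weights proportional to the stabilizer sizes. The lemma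
  \<open>pmf_sample_tuple\<close> below justifies the use of \<open>embed_pmf\<close> for finite groups.\<close>

definition sample_tuple :: "('a, 'b) monoid_scheme \<Rightarrow> nat \<Rightarrow> (nat \<Rightarrow> 'a) pmf" where
  "sample_tuple G k = embed_pmf (\<lambda>x.
     if x \<in> tuples G k
     then real (card (Stab G k x)) / real (\<Sum>y\<in>tuples G k. card (Stab G k y))
     else 0)"

definition pass_prob :: "('a, 'b) monoid_scheme \<Rightarrow> nat \<Rightarrow> ('a \<Rightarrow> 'a) \<Rightarrow> real" where
  "pass_prob G k f = measure_pmf.prob (sample_tuple G k)
     {x. (\<lambda>i\<in>{1..k}. f (x i)) \<in> Gamma_image G k x}"

lemma finite_tuples: "finite (carrier G) \<Longrightarrow> finite (tuples G k)"
  unfolding tuples_def by (intro finite_PiE) auto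

lemma finite_auto:
  assumes "finite (carrier G)"
  shows "finite (auto G)"
proof (rule finite_subset)
  show "auto G \<subseteq> carrier G \<rightarrow>\<^sub>E carrier G"
    by (auto simp: auto_def hom_def Bij_def PiE_def)
  show "finite (carrier G \<rightarrow>\<^sub>E carrier G)"
    using assms by (intro finite_PiE)
qed

lemma card_Stab_pos:
  assumes "group G" "finite (carrier G)" "x \<in> tuples G k"
  shows "card (Stab G k x) > 0"
proof -
  have "(\<lambda>g\<in>carrier G. g) \<in> Stab G k x"
    using group.id_in_auto[OF assms(1)] assms(3) by (auto simp: Stab_def tuples_def)
  moreover have "finite (Stab G k x)"
    using finite_auto[OF assms(2)] by (simp add: Stab_def)
  ultimately show ?thesis by (auto simp: card_gt_0_iff)
qed

lemma pmf_sample_tuple: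
  assumes "group G" "finite (carrier G)"
  shows "pmf (sample_tuple G k) x =
    (if x \<in> tuples G k
     then real (card (Stab G k x)) / real (\<Sum>y\<in>tuples G k. card (Stab G k y))
     else 0)" (is "_ = ?w x")
  unfolding sample_tuple_def
proof (rule pmf_embed_pmf)
  let ?T = "tuples G k" and ?S = "\<Sum>y\<in>tuples G k. card (Stab G k y)"
  have fin: "finite ?T" using assms(2) by (rule finite_tuples)
  have "?T \<noteq> {}"
    using monoid.one_closed[OF group.is_monoid[OF assms(1)]]
    by (auto simp: tuples_def PiE_eq_empty_iff)
  hence pos: "?S > 0"
    using fin card_Stab_pos[OF assms] by (intro sum_pos) auto
  have "(\<integral>\<^sup>+x. ennreal (?w x) \<partial>count_space UNIV) = (\<Sum>x\<in>?T. ennreal (?w x))"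
    by (rule nn_integral_count_space'[OF fin]) auto
  also have "\<dots> = ennreal (\<Sum>x\<in>?T. ?w x)" by (rule sum_ennreal) (simp add: sum_nonneg)
  also have "(\<Sum>x\<in>?T. ?w x) = 1"
    using pos by (simp flip: sum_divide_distrib of_nat_sum)
  finally show "(\<integral>\<^sup>+x. ennreal (?w x) \<partial>count_space UNIV) = 1" by simp
qed (simp add: sum_nonneg)

end

theory Submission
  imports Defs
begin

text \<open>If some automorphism agrees with \<open>f\<close> on a tuple \<open>x\<close>, the automorphisms doing so form a
  coset of \<open>Stab x\<close>. Double counting therefore gives
  \<open>\<delta>\<^sub>k(f) = (\<Sum>\<phi>. c(\<phi>)\<^sup>k) / (\<Sum>\<phi>. F(\<phi>)\<^sup>k)\<close>, where \<open>c(\<phi>)\<close> counts the agreements of \<open>\<phi>\<close> with \<open>f\<close>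
  and \<open>F(\<phi>)\<close> the fixed points of \<open>\<phi>\<close>, and for \<open>k = 2\<close> it gives \<open>(\<Sum>\<phi>. c(\<phi>)\<^sup>2) \<le> (\<Sum>\<phi>. F(\<phi>)\<^sup>2)\<close>. With \<open>M\<close> the
  largest agreement count, the numerator is at most \<open>M\<^sup>k\<^sup>-\<^sup>2 (\<Sum>\<phi>. F(\<phi>)\<^sup>2)\<close>, so it suffices that
  \<open>p\<^sup>k\<^sup>-\<^sup>2 (\<Sum>\<phi>. F(\<phi>)\<^sup>2) \<le> (\<Sum>\<phi>. F(\<phi>)\<^sup>k)\<close>. Fixed points form a subgroup, so \<open>F(\<phi>) \<ge> p\<close> or \<open>F(\<phi>) \<le> 2\<close>;
  the at most \<open>p\<^sup>2\<close> automorphisms of the second kind lose at most \<open>4p\<^sup>k\<close> in total, which the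
  identity, with \<open>F = 2p\<close>, makes up for.\<close>

section \<open>Agreement counts and the automorphism group\<close>

definition agree_count :: "('a, 'b) monoid_scheme \<Rightarrow> ('a \<Rightarrow> 'a) \<Rightarrow> ('a \<Rightarrow> 'a) \<Rightarrow> nat" where
  "agree_count G f \<phi> = card {x \<in> carrier G. f x = \<phi> x}"

lemma agr_eq_agree_count:
  assumes "finite (carrier G)" "carrier G \<noteq> {}"
  shows "agr G f \<phi> = agree_count G f \<phi> / card (carrier G)"
  using assms by (simp add: agr_def agree_count_def measure_pmf_of_set Int_def)

lemma Gamma_image_iff:
  "(\<lambda>i\<in>{1..k}. f (x i)) \<in> Gamma_image G k x \<longleftrightarrow> (\<exists>\<phi>\<in>auto G. \<forall>i\<in>{1..k}. f (x i) = \<phi> (x i))"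
  unfolding Gamma_image_def Gamma_def image_iff
  by (intro bex_cong refl) (auto simp: fun_eq_iff restrict_def)

lemma auto_compose:
  assumes "group G" "\<phi> \<in> auto G" "\<psi> \<in> auto G"
  shows "compose (carrier G) \<phi> \<psi> \<in> auto G"
proof -
  interpret A: group "AutoGroup G" using assms(1) by (rule group.AutoGroup)
  show ?thesis
    using A.m_closed[of \<phi> \<psi>] assms(2,3)
    by (auto simp: AutoGroup_def BijGroup_def auto_def)
qed

text \<open>The witness is the inverse in \<open>AutoGroup G\<close>. The unit of that group is the
  identity restricted to the carrier, so cancellation is claimed on the carrier only.\<close>

lemma auto_inverse:
  assumes "group G" "\<phi> \<in> auto G"
  obtains \<psi> where "\<psi> \<in> auto G" "\<And>x. x \<in> carrier G \<Longrightarrow> \<psi> (\<phi> x) = x"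
    "\<And>x. x \<in> carrier G \<Longrightarrow> \<phi> (\<psi> x) = x"
proof -
  interpret A: group "AutoGroup G" using assms(1) by (rule group.AutoGroup)
  have phi: "\<phi> \<in> carrier (AutoGroup G)" using assms(2) by (simp add: AutoGroup_def)
  define \<psi> where "\<psi> = inv\<^bsub>AutoGroup G\<^esub> \<phi>"
  have psi: "\<psi> \<in> carrier (AutoGroup G)" using phi by (simp add: \<psi>_def)
  have sub: "\<phi> \<in> Bij (carrier G)" "\<psi> \<in> Bij (carrier G)"
    using phi psi by (auto simp: AutoGroup_def auto_def)
  have "compose (carrier G) \<psi> \<phi> = (\<lambda>x\<in>carrier G. x)" "compose (carrier G) \<phi> \<psi> = (\<lambda>x\<in>carrier G. x)"
    using A.l_inv[OF phi, folded \<psi>_def] A.r_inv[OF phi, folded \<psi>_def] sub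
    by (simp_all add: AutoGroup_def BijGroup_def)
  with psi show ?thesis
    by (intro that[of \<psi>]) (auto simp: AutoGroup_def compose_def fun_eq_iff restrict_def split: if_splits)
qed

lemma auto_carrier: "\<phi> \<in> auto G \<Longrightarrow> x \<in> carrier G \<Longrightarrow> \<phi> x \<in> carrier G"
  by (auto simp: auto_def hom_def)

lemma auto_mult:
  "\<phi> \<in> auto G \<Longrightarrow> x \<in> carrier G \<Longrightarrow> y \<in> carrier G \<Longrightarrow> \<phi> (x \<otimes>\<^bsub>G\<^esub> y) = \<phi> x \<otimes>\<^bsub>G\<^esub> \<phi> y"
  by (auto simp: auto_def hom_def)

lemma auto_one: "group G \<Longrightarrow> \<phi> \<in> auto G \<Longrightarrow> \<phi> \<one>\<^bsub>G\<^esub> = \<one>\<^bsub>G\<^esub>"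
  by (rule hom_one[of _ G G]) (auto simp: auto_def)

lemma auto_inj_on: "\<phi> \<in> auto G \<Longrightarrow> inj_on \<phi> (carrier G)"
  by (auto simp: auto_def Bij_def bij_betw_def)

lemma auto_extensional: "\<phi> \<in> auto G \<Longrightarrow> \<phi> \<in> extensional (carrier G)"
  by (auto simp: auto_def Bij_def)

section \<open>Double counting of automorphisms and tuples\<close>

lemma card_agreeing_auto:
  assumes "group G" "x \<in> tuples G k"
  shows "card {\<phi> \<in> auto G. \<forall>i\<in>{1..k}. f (x i) = \<phi> (x i)} =
    (if (\<lambda>i\<in>{1..k}. f (x i)) \<in> Gamma_image G k x then card (Stab G k x) else 0)"
proof (cases "(\<lambda>i\<in>{1..k}. f (x i)) \<in> Gamma_image G k x")
  case False
  hence "{\<phi> \<in> auto G. \<forall>i\<in>{1..k}. f (x i) = \<phi> (x i)} = {}"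
    unfolding Gamma_image_iff by blast
  with False show ?thesis by (simp del: Collect_empty_eq)
next
  case True
  then obtain \<alpha> where \<alpha>: "\<alpha> \<in> auto G" "\<And>i. i \<in> {1..k} \<Longrightarrow> f (x i) = \<alpha> (x i)"
    unfolding Gamma_image_iff by blast
  obtain \<beta> where \<beta>: "\<beta> \<in> auto G" "\<And>y. y \<in> carrier G \<Longrightarrow> \<beta> (\<alpha> y) = y"
    "\<And>y. y \<in> carrier G \<Longrightarrow> \<alpha> (\<beta> y) = y"
    using auto_inverse[OF assms(1) \<alpha>(1)] by blast
  have x: "x i \<in> carrier G" if "i \<in> {1..k}" for i
    using assms(2) that by (auto simp: tuples_def)
  \<comment> \<open>Stated for arbitrary maps so that it serves both orders of \<alpha> and \<beta>.
    Off the carrier both sides are \<open>undefined\<close>, because \<open>\<phi>\<close> is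
    extensional.\<close>
  have cancel: "compose (carrier G) \<gamma> (compose (carrier G) \<gamma>' \<phi>) = \<phi>"
    if "\<phi> \<in> auto G" "\<And>y. y \<in> carrier G \<Longrightarrow> \<gamma> (\<gamma>' y) = y" for \<phi> \<gamma> \<gamma>'
    using that auto_carrier[OF that(1)] auto_extensional[OF that(1)]
    by (intro extensionalityI[of _ "carrier G"]) (auto simp: compose_def)
  \<comment> \<open>Left translation by \<alpha> maps the stabilizer onto its coset; left
    translation by \<beta> undoes it.\<close>
  have "bij_betw (compose (carrier G) \<alpha>) (Stab G k x)
     {\<phi> \<in> auto G. \<forall>i\<in>{1..k}. f (x i) = \<phi> (x i)}"
  proof (rule bij_betwI[where g = "compose (carrier G) \<beta>"])
    show "compose (carrier G) \<alpha> \<in> Stab G k x \<rightarrow> {\<phi> \<in> auto G. \<forall>i\<in>{1..k}. f (x i) = \<phi> (x i)}"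
      using \<alpha> x by (auto simp: Stab_def auto_compose[OF assms(1)] compose_eq)
    show "compose (carrier G) \<beta> \<in> {\<phi> \<in> auto G. \<forall>i\<in>{1..k}. f (x i) = \<phi> (x i)} \<rightarrow> Stab G k x"
    proof
      fix \<phi> assume "\<phi> \<in> {\<phi> \<in> auto G. \<forall>i\<in>{1..k}. f (x i) = \<phi> (x i)}"
      hence \<phi>: "\<phi> \<in> auto G" "\<And>i. i \<in> {1..k} \<Longrightarrow> \<phi> (x i) = \<alpha> (x i)"
        using \<alpha>(2) by auto
      show "compose (carrier G) \<beta> \<phi> \<in> Stab G k x"
        using \<phi>(1) \<phi>(2) \<beta>(1,2) x
        by (simp add: Stab_def auto_compose[OF assms(1)] compose_eq)
    qed
  qed (use cancel \<beta> in \<open>auto simp: Stab_def\<close>)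
  with True show ?thesis by (simp add: bij_betw_same_card)
qed

text \<open>Both sides count pairs of an automorphism and a tuple on which it agrees with
  \<open>f\<close>. For a fixed automorphism, the \<open>k\<close> entries range independently over
  its agreement set.\<close>

lemma sum_agree_count_power:
  assumes "group G" "finite (carrier G)"
  shows "(\<Sum>\<phi>\<in>auto G. agree_count G f \<phi> ^ k) =
    (\<Sum>x\<in>tuples G k. if (\<lambda>i\<in>{1..k}. f (x i)) \<in> Gamma_image G k x then card (Stab G k x) else 0)"
proof -
  note fin = finite_auto[OF assms(2)] finite_tuples[OF assms(2), of k]
  have "agree_count G f \<phi> ^ k = card {x \<in> tuples G k. \<forall>i\<in>{1..k}. f (x i) = \<phi> (x i)}" for \<phi>
  proof -
    have "{x \<in> tuples G k. \<forall>i\<in>{1..k}. f (x i) = \<phi> (x i)} =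
        {1..k} \<rightarrow>\<^sub>E {y \<in> carrier G. f y = \<phi> y}"
      by (auto simp: tuples_def PiE_def)
    thus ?thesis by (simp add: agree_count_def card_PiE)
  qed
  hence "(\<Sum>\<phi>\<in>auto G. agree_count G f \<phi> ^ k) =
      (\<Sum>\<phi>\<in>auto G. \<Sum>x\<in>tuples G k. of_bool (\<forall>i\<in>{1..k}. f (x i) = \<phi> (x i)))"
    using fin by (simp add: Int_def)
  also have "\<dots> = (\<Sum>x\<in>tuples G k. \<Sum>\<phi>\<in>auto G. of_bool (\<forall>i\<in>{1..k}. f (x i) = \<phi> (x i)))"
    by (rule sum.swap)
  also have "\<dots> = (\<Sum>x\<in>tuples G k. card {\<phi> \<in> auto G. \<forall>i\<in>{1..k}. f (x i) = \<phi> (x i)})"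
    using fin by (simp add: Int_def)
  also have "\<dots> = (\<Sum>x\<in>tuples G k.
      if (\<lambda>i\<in>{1..k}. f (x i)) \<in> Gamma_image G k x then card (Stab G k x) else 0)"
    by (intro sum.cong refl card_agreeing_auto[OF assms(1)])
  finally show ?thesis .
qed

text \<open>For the identity map in place of \<open>f\<close>, the identity automorphism shows that
  every tuple contributes. This rewrites the normalizing constant of \<open>sample_tuple\<close> as
  a power sum of fixed-point counts.\<close>

lemma sum_fixed_points_power:
  assumes "group G" "finite (carrier G)"
  shows "(\<Sum>\<phi>\<in>auto G. agree_count G (\<lambda>x. x) \<phi> ^ k) = (\<Sum>x\<in>tuples G k. card (Stab G k x))"
proof -
  have "(\<lambda>i\<in>{1..k}. x i) \<in> Gamma_image G k x" if "x \<in> tuples G k" for x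
    unfolding Gamma_image_iff[where f = "\<lambda>y. y"]
    using group.id_in_auto[OF assms(1)] that by (intro bexI) (auto simp: tuples_def)
  thus ?thesis by (simp add: sum_agree_count_power[OF assms])
qed

text \<open>In the sums over tuples, each tuple contributes its stabilizer size or 0 on the left,
  and always the stabilizer size on the right.\<close>

lemma sum_agree_count_power_le:
  assumes "group G" "finite (carrier G)"
  shows "(\<Sum>\<phi>\<in>auto G. agree_count G f \<phi> ^ k) \<le> (\<Sum>\<phi>\<in>auto G. agree_count G (\<lambda>x. x) \<phi> ^ k)"
  unfolding sum_fixed_points_power[OF assms] unfolding sum_agree_count_power[OF assms]
  by (rule sum_mono) auto

lemma pass_prob_eq:
  assumes "group G" "finite (carrier G)"
  shows "pass_prob G k f = real (\<Sum>\<phi>\<in>auto G. agree_count G f \<phi> ^ k) /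
    real (\<Sum>\<phi>\<in>auto G. agree_count G (\<lambda>x. x) \<phi> ^ k)"
proof -
  let ?P = "\<lambda>x. (\<lambda>i\<in>{1..k}. f (x i)) \<in> Gamma_image G k x"
  let ?D = "\<Sum>y\<in>tuples G k. card (Stab G k y)"
  have fin: "finite (tuples G k)" using assms(2) by (rule finite_tuples)
  \<comment> \<open>The event defining \<open>pass_prob\<close> ranges over all functions; cutting
    it down to the support makes it finite, so its probability is a finite sum.\<close>
  have supp: "set_pmf (sample_tuple G k) \<subseteq> tuples G k"
    by (auto simp: set_pmf_eq pmf_sample_tuple[OF assms] split: if_splits)
  have "pass_prob G k f = measure_pmf.prob (sample_tuple G k) {x \<in> tuples G k. ?P x}"
    unfolding pass_prob_def using supp by (intro measure_prob_cong_0) (auto simp: set_pmf_iff)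
  also have "\<dots> = (\<Sum>x\<in>{x \<in> tuples G k. ?P x}. pmf (sample_tuple G k) x)"
    using fin by (intro measure_measure_pmf_finite) auto
  also have "\<dots> = (\<Sum>x\<in>{x \<in> tuples G k. ?P x}. real (card (Stab G k x)) / real ?D)"
    by (intro sum.cong) (auto simp: pmf_sample_tuple[OF assms])
  also have "\<dots> = real (\<Sum>x\<in>{x \<in> tuples G k. ?P x}. card (Stab G k x)) / real ?D"
    by (simp add: sum_divide_distrib)
  also have "(\<Sum>x\<in>{x \<in> tuples G k. ?P x}. card (Stab G k x)) =
      (\<Sum>x\<in>tuples G k. if ?P x then card (Stab G k x) else 0)"
    using fin by (rule sum.inter_filter)
  finally show ?thesis
    by (simp only: sum_fixed_points_power[OF assms] sum_agree_count_power[OF assms])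
qed

section \<open>Fixed points and automorphisms of dihedral groups\<close>

lemma agree_count_id_dvd_order:
  assumes "group G" "\<phi> \<in> auto G"
  shows "agree_count G (\<lambda>x. x) \<phi> dvd Coset.order G"
proof -
  interpret G: group G by fact
  interpret h: group_hom G G \<phi>
    using assms by (intro group_hom.intro group_hom_axioms.intro) (auto simp: auto_def)
  have "subgroup {x \<in> carrier G. x = \<phi> x} G"
    by (rule G.subgroupI) (auto intro: exI[of _ "\<one>\<^bsub>G\<^esub>"])
  from G.lagrange[OF this] show ?thesis
    unfolding agree_count_def by (metis dvd_triv_right)
qed

text \<open>An automorphism is determined by its values at the generators \<open>(1, False)\<close>
  and \<open>(0, True)\<close>. The first value is a rotation, since reflections square to the
  identity; the second is a reflection, since for odd \<open>n\<close> no rotation has order 2. This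
  leaves at most \<open>n\<close> choices for each.\<close>

lemma card_auto_dihedral_le:
  assumes "odd n" "n > 1"
  shows "card (auto (dihedral n)) \<le> n\<^sup>2"
proof -
  define G where "G = dihedral n"
  have grp: "group G" unfolding G_def using assms by (intro group_dihedral) auto
  interpret G: group G by (rule grp)
  have car: "(a, s) \<in> carrier G \<longleftrightarrow> 0 \<le> a \<and> a < int n" for a s
    by (auto simp: G_def dihedral_def)
  have mult: "(a, s) \<otimes>\<^bsub>G\<^esub> (b, t) = ((if s then a - b else a + b) mod int n, s \<noteq> t)" for a b s t
    by (simp add: G_def dihedral_def)
  have one: "\<one>\<^bsub>G\<^esub> = (0, False)" by (simp add: G_def dihedral_def)
  \<comment> \<open>Makes \<open>(2, False)\<close> an element of the carrier different from the
    identity.\<close>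
  have n2: "n > 2" using assms by presburger
  have rho: "\<exists>a. \<phi> (1, False) = (a, False) \<and> a \<in> {0..<int n}" if "\<phi> \<in> auto G" for \<phi>
  proof -
    obtain a s where as: "\<phi> (1, False) = (a, s)" by force
    have a: "0 \<le> a" "a < int n"
      using auto_carrier[OF that, of "(1, False)"] assms as by (auto simp: car)
    have "\<not> s"
    proof
      assume s
      have "\<phi> (2, False) = \<phi> ((1, False) \<otimes>\<^bsub>G\<^esub> (1, False))" using n2 by (simp add: mult)
      also have "\<dots> = (a, s) \<otimes>\<^bsub>G\<^esub> (a, s)"
        using assms as by (subst auto_mult[OF that]) (auto simp: car)
      also have "\<dots> = \<phi> (0, False)" using \<open>s\<close> auto_one[OF grp that] by (simp add: mult one)
      finally show False
        using inj_onD[OF auto_inj_on[OF that], of "(2, False)" "(0, False)"] n2 by (simp add: car)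
    qed
    with as a show ?thesis by auto
  qed
  have sigma: "\<exists>b. \<phi> (0, True) = (b, True) \<and> b \<in> {0..<int n}" if "\<phi> \<in> auto G" for \<phi>
  proof -
    obtain b s where bs: "\<phi> (0, True) = (b, s)" by force
    have b: "0 \<le> b" "b < int n"
      using auto_carrier[OF that, of "(0, True)"] assms bs by (auto simp: car)
    have s
    proof (rule ccontr)
      assume "\<not> s"
      have "(0, False) = \<phi> (0, False)" using auto_one[OF grp that] by (simp add: one)
      also have "\<dots> = \<phi> ((0, True) \<otimes>\<^bsub>G\<^esub> (0, True))" by (simp add: mult)
      also have "\<dots> = (b, s) \<otimes>\<^bsub>G\<^esub> (b, s)"
        using assms bs by (subst auto_mult[OF that]) (auto simp: car)
      finally have "(2 * b) mod int n = 0" using \<open>\<not> s\<close> by (simp add: mult)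
      hence "int n dvd 2 * b" by presburger
      moreover have "coprime (int n) 2" using assms(1) by simp
      ultimately have "int n dvd b" by (simp add: coprime_dvd_mult_right_iff)
      hence "b = 0" using b zdvd_not_zless[of b "int n"] by (cases "b = 0") auto
      hence "\<phi> (0, True) = \<phi> (0, False)"
        using bs \<open>\<not> s\<close> auto_one[OF grp that] by (simp add: one)
      thus False
        using inj_onD[OF auto_inj_on[OF that], of "(0, True)" "(0, False)"] assms by (simp add: car)
    qed
    with bs b show ?thesis by auto
  qed
  \<comment> \<open>The Boolean components of both images are already fixed by \<open>rho\<close>
    and \<open>sigma\<close>.\<close>
  let ?code = "\<lambda>\<phi>. (fst (\<phi> (1, False)), fst (\<phi> (0, True)))"
  have "inj_on ?code (auto G)"
  proof (rule inj_onI)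
    fix \<phi> \<psi> assume phi: "\<phi> \<in> auto G" and psi: "\<psi> \<in> auto G" and eq: "?code \<phi> = ?code \<psi>"
    have gen: "\<phi> (1, False) = \<psi> (1, False)" "\<phi> (0, True) = \<psi> (0, True)"
      using eq rho[OF phi] rho[OF psi] sigma[OF phi] sigma[OF psi] by auto
    \<comment> \<open>The bound on \<open>m\<close> keeps the successive sums from wrapping around
      modulo \<open>n\<close>.\<close>
    have rot: "m < n \<Longrightarrow> \<phi> (int m, False) = \<psi> (int m, False)" for m
    proof (induction m)
      case 0
      show ?case using auto_one[OF grp phi] auto_one[OF grp psi] by (simp add: one)
    next
      case (Suc m)
      have "(int (Suc m), False) = (int m, False) \<otimes>\<^bsub>G\<^esub> (1, False)"
        using Suc.prems by (simp add: mult)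
      thus ?case using Suc assms gen by (simp add: auto_mult[OF phi] auto_mult[OF psi] car)
    qed
    have rot': "\<phi> (a, False) = \<psi> (a, False)" if "(a, False) \<in> carrier G" for a
      using rot[of "nat a"] that by (simp add: car nat_less_iff)
    show "\<phi> = \<psi>"
    proof (rule extensionalityI[OF auto_extensional[OF phi] auto_extensional[OF psi]])
      fix x assume x: "x \<in> carrier G"
      obtain a s where as: "x = (a, s)" by force
      show "\<phi> x = \<psi> x"
      proof (cases s)
        case True
        have c: "(a, False) \<in> carrier G" "(0, True) \<in> carrier G"
          using x as assms by (auto simp: car)
        have x_eq: "x = (a, False) \<otimes>\<^bsub>G\<^esub> (0, True)" using x True by (simp add: as mult car)
        show ?thesis
          unfolding x_eq auto_mult[OF phi c] auto_mult[OF psi c] rot'[OF c(1)] gen(2) ..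
      qed (use as x rot' in auto)
    qed
  qed
  moreover have "?code ` auto G \<subseteq> {0..<int n} \<times> {0..<int n}"
    using rho sigma by fastforce
  ultimately have "card (auto G) \<le> card ({0..<int n} \<times> {0..<int n})"
    by (intro card_inj_on_le) auto
  thus ?thesis by (simp add: G_def card_cartesian_product power2_eq_square)
qed

lemma sum_fixed_points_dihedral:
  fixes p m :: nat
  assumes "prime p" "p > 2" "m > 0"
  defines "F \<equiv> agree_count (dihedral p) (\<lambda>x. x)"
  shows "p ^ m * (\<Sum>\<phi>\<in>auto (dihedral p). F \<phi> ^ 2) \<le> (\<Sum>\<phi>\<in>auto (dihedral p). F \<phi> ^ (m + 2))"
proof -
  define G where "G = dihedral p"
  have grp: "group G" unfolding G_def using assms by (intro group_dihedral) auto
  have fin: "finite (carrier G)" by (simp add: G_def dihedral_def)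
  have cardG: "card (carrier G) = 2 * p"
    using order_dihedral[of p] by (simp add: G_def Coset.order_def)
  let ?id = "\<lambda>x\<in>carrier G. x"
  have id: "?id \<in> auto G" using grp by (rule group.id_in_auto)
  have F_id: "F ?id = 2 * p"
    unfolding F_def agree_count_def G_def[symmetric] using cardG by (simp cong: conj_cong)
  \<comment> \<open>As \<open>F \<phi>\<close> divides \<open>2 * p\<close>, it is a multiple of
    \<open>p\<close> or divides 2. The slack \<open>4 * p ^ m\<close> is there for the second
    case.\<close>
  have split: "p ^ m * F \<phi> ^ 2 \<le> F \<phi> ^ (m + 2) + 4 * p ^ m" if "\<phi> \<in> auto G" for \<phi>
  proof -
    have dvd: "F \<phi> dvd 2 * p"
      using agree_count_id_dvd_order[OF grp that] order_dihedral[of p] by (simp add: F_def G_def)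
    show ?thesis
    proof (cases "p dvd F \<phi>")
      case True
      moreover have "F \<phi> > 0" using dvd assms by (intro Nat.gr0I) auto
      ultimately have "p \<le> F \<phi>" by (rule dvd_imp_le)
      hence "p ^ m * F \<phi> ^ 2 \<le> F \<phi> ^ m * F \<phi> ^ 2" by (intro mult_right_mono power_mono) auto
      thus ?thesis by (simp only: power_add)
    next
      case False
      hence "coprime (F \<phi>) p" using assms(1) by (metis coprime_commute prime_imp_coprime)
      hence "F \<phi> dvd 2" using dvd by (simp add: coprime_dvd_mult_left_iff)
      hence "F \<phi> \<le> 2" by (simp add: dvd_imp_le)
      hence "F \<phi> ^ 2 \<le> 2 ^ 2" by (intro power_mono) auto
      hence "p ^ m * F \<phi> ^ 2 \<le> p ^ m * 4" by (intro mult_left_mono) auto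
      thus ?thesis by linarith
    qed
  qed
  have "card (auto G - {?id}) \<le> card (auto G)" by (rule card_Diff1_le)
  also have "\<dots> \<le> p\<^sup>2"
    unfolding G_def using card_auto_dihedral_le[of p] prime_odd_nat[of p] assms by simp
  finally have card: "card (auto G - {?id}) * (4 * p ^ m) \<le> p\<^sup>2 * (4 * p ^ m)"
    by (rule mult_right_mono) simp
  have "p ^ m * (\<Sum>\<phi>\<in>auto G. F \<phi> ^ 2) = p ^ m * F ?id ^ 2 + (\<Sum>\<phi>\<in>auto G - {?id}. p ^ m * F \<phi> ^ 2)"
    using id finite_auto[OF fin] by (simp add: sum.remove[of _ ?id] distrib_left sum_distrib_left)
  also have "(\<Sum>\<phi>\<in>auto G - {?id}. p ^ m * F \<phi> ^ 2) \<le>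
      (\<Sum>\<phi>\<in>auto G - {?id}. F \<phi> ^ (m + 2) + 4 * p ^ m)"
    using split by (intro sum_mono) auto
  also have "\<dots> \<le> (\<Sum>\<phi>\<in>auto G - {?id}. F \<phi> ^ (m + 2)) + p\<^sup>2 * (4 * p ^ m)"
    unfolding sum.distrib sum_constant of_nat_id by (intro add_left_mono card)
  also have "p ^ m * F ?id ^ 2 + ((\<Sum>\<phi>\<in>auto G - {?id}. F \<phi> ^ (m + 2)) + p\<^sup>2 * (4 * p ^ m)) =
      2 * (4 * p ^ (m + 2)) + (\<Sum>\<phi>\<in>auto G - {?id}. F \<phi> ^ (m + 2))"
    unfolding F_id by (simp add: power_add power2_eq_square)
  \<comment> \<open>One copy of \<open>4 * p ^ (m + 2)\<close> is the identity's own term on the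
    left, the other is the total slack. The identity pays for both because
    \<open>2 ^ (m + 2)\<close> is at least 8 when \<open>m\<close> is positive.\<close>
  also have "2 * (4 * p ^ (m + 2)) \<le> F ?id ^ (m + 2)"
  proof -
    have "(2::nat) ^ 3 \<le> 2 ^ (m + 2)" using assms(3) by (intro power_increasing) auto
    hence "2 ^ 3 * p ^ (m + 2) \<le> 2 ^ (m + 2) * p ^ (m + 2)" by (rule mult_right_mono) simp
    thus ?thesis unfolding F_id by (simp add: power_mult_distrib)
  qed
  also have "F ?id ^ (m + 2) + (\<Sum>\<phi>\<in>auto G - {?id}. F \<phi> ^ (m + 2)) = (\<Sum>\<phi>\<in>auto G. F \<phi> ^ (m + 2))"
    using id finite_auto[OF fin] by (simp add: sum.remove[of _ ?id])
  finally show ?thesis by (simp add: G_def)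
qed

section \<open>From power sums to an automorphism of large agreement\<close>

theorem theorem5p7:
  fixes p k :: nat and f :: "int \<times> bool \<Rightarrow> int \<times> bool"
  assumes "prime p" and "p > 3" and "k \<ge> 3"
    and "f \<in> carrier (dihedral p) \<rightarrow> carrier (dihedral p)"
  shows "\<exists>\<phi>\<in>auto (dihedral p).
           agr (dihedral p) f \<phi> \<ge> 1 / 2 * pass_prob (dihedral p) k f powr (1 / (real k - 2))"
proof -
  define G where "G = dihedral p"
  define m where "m = k - 2"
  have m: "m > 0" "k = m + 2" using assms(3) by (auto simp: m_def)
  have grp: "group G" unfolding G_def using assms(2) by (intro group_dihedral) auto
  have fin: "finite (carrier G)" by (simp add: G_def dihedral_def)
  have cardG: "card (carrier G) = 2 * p"
    using order_dihedral[of p] by (simp add: G_def Coset.order_def)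
  have ne: "carrier G \<noteq> {}" using cardG assms(2) by force
  define c where "c = agree_count G f"
  define F where "F = agree_count G (\<lambda>x. x)"
  have A: "finite (auto G)" "auto G \<noteq> {}"
    using finite_auto[OF fin] group.id_in_auto[OF grp] by auto
  hence "Max (c ` auto G) \<in> c ` auto G" by (intro Max_in) auto
  then obtain \<phi> where \<phi>: "\<phi> \<in> auto G" "c \<phi> = Max (c ` auto G)" by auto
  have max: "c \<psi> \<le> c \<phi>" if "\<psi> \<in> auto G" for \<psi>
    unfolding \<phi>(2) using A that by (intro Max_ge) auto
  let ?N = "\<Sum>\<psi>\<in>auto G. c \<psi> ^ k" and ?D = "\<Sum>\<psi>\<in>auto G. F \<psi> ^ k"
  \<comment> \<open>Two of the \<open>k\<close> factors are kept for the second-moment comparison;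
    the other \<open>m\<close> are bounded by the maximum.\<close>
  have "?N \<le> (\<Sum>\<psi>\<in>auto G. c \<phi> ^ m * c \<psi> ^ 2)"
    unfolding m(2) power_add using max by (intro sum_mono mult_right_mono power_mono) auto
  also have "\<dots> = c \<phi> ^ m * (\<Sum>\<psi>\<in>auto G. c \<psi> ^ 2)" by (simp add: sum_distrib_left)
  also have "\<dots> \<le> c \<phi> ^ m * (\<Sum>\<psi>\<in>auto G. F \<psi> ^ 2)"
    unfolding c_def F_def by (intro mult_left_mono sum_agree_count_power_le grp fin) auto
  finally have "p ^ m * ?N \<le> p ^ m * (c \<phi> ^ m * (\<Sum>\<psi>\<in>auto G. F \<psi> ^ 2))"
    by (rule mult_left_mono) simp
  also have "\<dots> = c \<phi> ^ m * (p ^ m * (\<Sum>\<psi>\<in>auto G. F \<psi> ^ 2))" by simp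
  also have "\<dots> \<le> c \<phi> ^ m * ?D"
    using sum_fixed_points_dihedral[of p m] assms(1,2) m
    by (intro mult_left_mono) (auto simp: G_def F_def)
  finally have "real (p ^ m * ?N) \<le> real (c \<phi> ^ m * ?D)" by (rule of_nat_mono)
  hence main: "real p ^ m * real ?N \<le> real (c \<phi>) ^ m * real ?D"
    by (simp only: of_nat_mult of_nat_power)
  have delta: "pass_prob G k f = real ?N / real ?D"
    unfolding c_def F_def using grp fin by (rule pass_prob_eq)
  have "pass_prob G k f \<le> (real (c \<phi>) / real p) ^ m"
  \<comment> \<open>Were the denominator 0, the quotient would be 0 by convention and the bound
    trivial.\<close>
  proof (cases "?D = 0")
    case False
    hence "real ?D > 0" by linarith
    with main assms(2) show ?thesis
      unfolding delta power_divide
      by (simp add: divide_le_eq pos_le_divide_eq mult.commute del: of_nat_sum of_nat_power)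
  qed (unfold delta, simp del: of_nat_sum)
  hence "pass_prob G k f powr (1 / real m) \<le> ((real (c \<phi>) / real p) ^ m) powr (1 / real m)"
    by (intro powr_mono2) (auto simp: pass_prob_def)
  also have "\<dots> = real (c \<phi>) / real p"
  \<comment> \<open>Turning the power into \<open>powr\<close> needs a positive base; for base 0
    both sides are 0.\<close>
  proof (cases "c \<phi> = 0")
    case False
    hence "real (c \<phi>) / real p > 0" using assms(2) by simp
    hence "((real (c \<phi>) / real p) ^ m) powr (1 / real m) = (real (c \<phi>) / real p) powr (real m * (1 / real m))"
      by (simp only: powr_powr flip: powr_realpow)
    with m(1) show ?thesis by simp
  qed (use m(1) in simp)
  \<comment> \<open>The factor 1/2 arises because the count is compared with \<open>p\<close>, while
    the group has \<open>2 * p\<close> elements.\<close>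
  finally have "1 / 2 * pass_prob G k f powr (1 / real m) \<le> real (c \<phi>) / real (2 * p)" by simp
  also have "\<dots> = agr G f \<phi>"
    unfolding agr_eq_agree_count[OF fin ne] cardG c_def ..
  finally show ?thesis using \<phi>(1) m by (auto simp: G_def)
qed

end
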